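(* There exist a semimartingale $Y$ and a sequence $(X^{n})_{n=1}^{\infty}$ of semimartingales starting at zero such that the following hold. 1. $\sup_{n}\int_{\Omega}\mathrm{var}(X^{n})_{\infty}\,d\mathbb{P}\leq 1$. 2. For every sequence $(\widetilde{X}^{n})_{n=1}^{\infty}$ with $\widetilde{X}^{n}\in\mathrm{co}\{X^{m}:m\geq n\}$ for all $n$, one has $$Y=\lim_{s\downarrow\cdot,\,s\in\mathbb{Q}_{+}}\ \lim_{n\to\infty}\widetilde{X}^{n}_{s}.$$ 3. For every sequence $(\widetilde{X}^{n})_{n=1}^{\infty}$ with $\widetilde{X}^{n}\in\mathrm{co}\{X^{m}:m\geq n\}$ for all $n$, one has $$\lim_{s\downarrow\cdot,\,s\in\mathbb{Q}_{+}}\ \lim_{n\to\infty}\int_{0}^{s}Y_{-}\,d\widetilde{X}^{n}\neq\int_{0}^{\cdot}Y_{-}\,dY.$$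
   Context: $(\Omega,\mathscr{F},\mathbb{P})$ is a probability space with a filtration $\mathbb{F}=(\mathscr{F}_{t})_{t\in[0,\infty)}$ satisfying the usual conditions, with $\mathscr{F}_{0}$ the $\mathbb{P}$-augmentation of the trivial $\sigma$-algebra. Semimartingales (càdlàg) are relative to $\mathbb{F}$; processes are identified up to evanescence (indistinguishability). $\int_{0}^{\cdot}\xi\,dX$ is the Itô stochastic integral. $Y_{-}$ is the left-limit process of $Y$, with $Y_{0-}=Y_{0}$. $\mathrm{var}(X)_t$ is the total variation of the paths of $X$ on $[0,t]$ and $\mathrm{var}(X)_\infty=\lim_{t\to\infty}\mathrm{var}(X)_t$. $\mathrm{co}$ denotes the convex hull (finite convex combinations). $\mathbb{Q}_{+}$ is the set of nonnegative rationals. $\lim_{n\to\infty}$ of random variables denotes the $\mathbb{P}$-a.s. limit. The process $\lim_{s\downarrow\cdot,\,s\in\mathbb{Q}_{+}}\lim_{n\to\infty}Z^{n}_{s}$ is defined as follows: for each $s\in\mathbb{Q}_{+}$, $\zeta_{s}=\lim_{n}Z^{n}_{s}$ exists $\mathbb{P}$-a.s., and, $\mathbb{P}$-a.s., for every $t\in[0,\infty)$ its value at $t$ is the limit of $\zeta_{s}$ as $s\in\mathbb{Q}_{+}$, $s>t$, $s\to t$. Existence of the displayed limits is part of the assertions; $=$ means indistinguishable, and $\neq$ means not indistinguishable. *)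

theory Defs
  imports "HOL-Probability.Probability"
begin

text \<open>
  A process is a function \<open>X :: real \<Rightarrow> 'a \<Rightarrow> real\<close>, of which only the values
  at times \<open>t \<ge> 0\<close> matter.  Path properties are required almost surely, so that all
  notions below are invariant under indistinguishability.
\<close>

type_synonym 'a process = "real \<Rightarrow> 'a \<Rightarrow> real"

text \<open>
  The filtration is indexed by all reals so that the library locale applies; the
  \<open>\<sigma>\<close>-algebras at negative times are arbitrary and play no role.  As \<open>M\<close> is
  complete, the augmentation of the trivial \<open>\<sigma>\<close>-algebra is generated by the null sets.
\<close>

locale stochastic_basis =
  prob_space M + complete_measure M + filtration "space M" F
  for M :: "'a measure" and F :: "real \<Rightarrow> 'a measure" +
  assumes subalg: "\<And>t. 0 \<le> t \<Longrightarrow> subalgebra M (F t)"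
    and right_continuous: "\<And>t. 0 \<le> t \<Longrightarrow> sets (F t) = (\<Inter>s\<in>{t<..}. sets (F s))"
    and sets_F_0: "sets (F 0) = sigma_sets (space M) (null_sets M)"

definition indistinguishable :: "'a measure \<Rightarrow> 'a process \<Rightarrow> 'a process \<Rightarrow> bool" where
  "indistinguishable M X Y \<longleftrightarrow> (AE \<omega> in M. \<forall>t\<ge>0. X t \<omega> = Y t \<omega>)"

definition adapted :: "(real \<Rightarrow> 'a measure) \<Rightarrow> 'a process \<Rightarrow> bool" where
  "adapted F X \<longleftrightarrow> (\<forall>t\<ge>0. X t \<in> borel_measurable (F t))"

definition cadlag_path :: "(real \<Rightarrow> real) \<Rightarrow> bool" where
  "cadlag_path x \<longleftrightarrow>
     (\<forall>t\<ge>0. (x \<longlongrightarrow> x t) (at_right t)) \<and> (\<forall>t>0. \<exists>l. (x \<longlongrightarrow> l) (at_left t))"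

definition caglad_path :: "(real \<Rightarrow> real) \<Rightarrow> bool" where
  "caglad_path x \<longleftrightarrow>
     (\<forall>t>0. (x \<longlongrightarrow> x t) (at_left t)) \<and> (\<forall>t\<ge>0. \<exists>l. (x \<longlongrightarrow> l) (at_right t))"

definition cadlag :: "'a measure \<Rightarrow> 'a process \<Rightarrow> bool" where
  "cadlag M X \<longleftrightarrow> (AE \<omega> in M. cadlag_path (\<lambda>t. X t \<omega>))"

definition caglad :: "'a measure \<Rightarrow> 'a process \<Rightarrow> bool" where
  "caglad M X \<longleftrightarrow> (AE \<omega> in M. caglad_path (\<lambda>t. X t \<omega>))"

definition left_limit :: "'a process \<Rightarrow> 'a process" where
  "left_limit Y t \<omega> = (if t \<le> 0 then Y 0 \<omega> else Lim (at_left t) (\<lambda>s. Y s \<omega>))"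

definition path_var :: "(real \<Rightarrow> real) \<Rightarrow> real \<Rightarrow> ennreal" where
  "path_var x t =
     (SUP (n, p) \<in> {(n :: nat, p :: nat \<Rightarrow> real).
          (\<forall>i\<le>n. p i \<in> {0..t}) \<and> (\<forall>i<n. p i \<le> p (Suc i))}.
        \<Sum>i<n. ennreal \<bar>x (p (Suc i)) - x (p i)\<bar>)"

definition path_var_infinity :: "(real \<Rightarrow> real) \<Rightarrow> ennreal" where
  "path_var_infinity x = Lim at_top (path_var x)"

definition martingale :: "'a measure \<Rightarrow> (real \<Rightarrow> 'a measure) \<Rightarrow> 'a process \<Rightarrow> bool" where
  "martingale M F N \<longleftrightarrow>
     adapted F N \<and> (\<forall>t\<ge>0. integrable M (N t)) \<and>
     (\<forall>s t. 0 \<le> s \<longrightarrow> s \<le> t \<longrightarrow> (AE \<omega> in M. real_cond_exp M (F s) (N t) \<omega> = N s \<omega>))"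

definition finite_stopping_time ::
  "'a measure \<Rightarrow> (real \<Rightarrow> 'a measure) \<Rightarrow> ('a \<Rightarrow> real) \<Rightarrow> bool" where
  "finite_stopping_time M F T \<longleftrightarrow> stopping_time F T \<and> (\<forall>\<omega>\<in>space M. 0 \<le> T \<omega>)"

definition local_martingale :: "'a measure \<Rightarrow> (real \<Rightarrow> 'a measure) \<Rightarrow> 'a process \<Rightarrow> bool" where
  "local_martingale M F N \<longleftrightarrow>
     adapted F N \<and> cadlag M N \<and>
     (\<exists>T :: nat \<Rightarrow> 'a \<Rightarrow> real.
        (\<forall>n. finite_stopping_time M F (T n)) \<and>
        (AE \<omega> in M. incseq (\<lambda>n. T n \<omega>) \<and> filterlim (\<lambda>n. T n \<omega>) at_top sequentially) \<and>
        (\<forall>n. martingale M F (\<lambda>t \<omega>. N (min t (T n \<omega>)) \<omega> - N 0 \<omega>)))"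

definition finite_variation :: "'a measure \<Rightarrow> (real \<Rightarrow> 'a measure) \<Rightarrow> 'a process \<Rightarrow> bool" where
  "finite_variation M F A \<longleftrightarrow>
     adapted F A \<and> cadlag M A \<and> (AE \<omega> in M. \<forall>t\<ge>0. path_var (\<lambda>s. A s \<omega>) t < \<infinity>)"

definition semimartingale :: "'a measure \<Rightarrow> (real \<Rightarrow> 'a measure) \<Rightarrow> 'a process \<Rightarrow> bool" where
  "semimartingale M F X \<longleftrightarrow>
     adapted F X \<and> cadlag M X \<and>
     (\<exists>N A. local_martingale M F N \<and> finite_variation M F A \<and>
        indistinguishable M X (\<lambda>t \<omega>. N t \<omega> + A t \<omega>))"

text \<open>
  The Ito integral of an adapted caglad integrand: the extension of the elementary integral,
  continuous for uniform convergence on compacts in probability (ucp).  The predicate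
  \<open>elementary_integral M F X H J\<close> says that \<open>H\<close> is the simple predictable process
  \<open>h0 1{0} + (\<Sum>i<k. h i 1(T i, T (i+1)])\<close> and that \<open>J\<close> is its integral with respect to
  \<open>X\<close>.  Integrals from \<open>0\<close> to \<open>t\<close> are over \<open>(0, t]\<close>, so they start at zero
  (in accordance with the convention that the left limit at \<open>0\<close> is the value at \<open>0\<close>).
\<close>

definition elementary_integral ::
  "'a measure \<Rightarrow> (real \<Rightarrow> 'a measure) \<Rightarrow> 'a process \<Rightarrow> 'a process \<Rightarrow> 'a process \<Rightarrow> bool" where
  "elementary_integral M F X H J \<longleftrightarrow>
     (\<exists>(k :: nat) (T :: nat \<Rightarrow> 'a \<Rightarrow> real) (h0 :: 'a \<Rightarrow> real) (h :: nat \<Rightarrow> 'a \<Rightarrow> real).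
        (\<forall>i\<le>k. finite_stopping_time M F (T i)) \<and>
        (\<forall>i<k. \<forall>\<omega>\<in>space M. T i \<omega> \<le> T (Suc i) \<omega>) \<and>
        h0 \<in> borel_measurable (F 0) \<and>
        (\<forall>i<k. h i \<in> borel_measurable (filtration.pre_sigma (space M) F (T i))) \<and>
        H = (\<lambda>t \<omega>. h0 \<omega> * indicator {0} t + (\<Sum>i<k. h i \<omega> * indicator {T i \<omega><..T (Suc i) \<omega>} t)) \<and>
        J = (\<lambda>t \<omega>. \<Sum>i<k. h i \<omega> * (X (min t (T (Suc i) \<omega>)) \<omega> - X (min t (T i \<omega>)) \<omega>)))"

text \<open>The event below is \<open>{sup s\<le>t. \<bar>Z n s - L s\<bar> > \<epsilon>}\<close>.\<close>

definition ucp_tendsto :: "'a measure \<Rightarrow> (nat \<Rightarrow> 'a process) \<Rightarrow> 'a process \<Rightarrow> bool" where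
  "ucp_tendsto M Z L \<longleftrightarrow>
     (\<forall>t\<ge>0. \<forall>\<epsilon>>0.
        (\<lambda>n. measure M {\<omega> \<in> space M. \<exists>s\<in>{0..t}. \<bar>Z n s \<omega> - L s \<omega>\<bar> > \<epsilon>}) \<longlonglongrightarrow> 0)"

definition is_ito_integral ::
  "'a measure \<Rightarrow> (real \<Rightarrow> 'a measure) \<Rightarrow> 'a process \<Rightarrow> 'a process \<Rightarrow> 'a process \<Rightarrow> bool" where
  "is_ito_integral M F H X Z \<longleftrightarrow>
     adapted F H \<and> caglad M H \<and> semimartingale M F X \<and> adapted F Z \<and> cadlag M Z \<and>
     (\<forall>Hs Js. (\<forall>n. elementary_integral M F X (Hs n) (Js n)) \<longrightarrow>
        ucp_tendsto M Hs H \<longrightarrow> ucp_tendsto M Js Z)"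

text \<open>For adapted caglad \<open>H\<close> and a semimartingale \<open>X\<close>, such a process exists and is
  unique up to indistinguishability.\<close>

definition ito_integral ::
  "'a measure \<Rightarrow> (real \<Rightarrow> 'a measure) \<Rightarrow> 'a process \<Rightarrow> 'a process \<Rightarrow> 'a process" where
  "ito_integral M F H X = (SOME Z. is_ito_integral M F H X Z)"

text \<open>Convex hull of a set of processes, processes being identified up to
  indistinguishability; compare the library fact \<open>convex_hull_explicit\<close>.\<close>

definition process_hull :: "'a measure \<Rightarrow> 'a process set \<Rightarrow> 'a process set" where
  "process_hull M S =
     {Z. \<exists>I u. finite I \<and> I \<subseteq> S \<and> (\<forall>x\<in>I. (0 :: real) \<le> u x) \<and> sum u I = 1 \<and>
        indistinguishable M Z (\<lambda>t \<omega>. \<Sum>x\<in>I. u x * x t \<omega>)}"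

text \<open>
  \<open>has_right_rational_limit M Z L\<close>: the iterated limit of \<open>Z n s\<close>, first as \<open>n\<close> tends to
  infinity at nonnegative rational times \<open>s\<close>, then as \<open>s\<close> decreases to \<open>t\<close>
  along the rationals, exists and equals \<open>L\<close>.
\<close>

definition has_right_rational_limit ::
  "'a measure \<Rightarrow> (nat \<Rightarrow> 'a process) \<Rightarrow> 'a process \<Rightarrow> bool" where
  "has_right_rational_limit M Z L \<longleftrightarrow>
     (\<exists>\<zeta> :: 'a process.
        (\<forall>s\<in>\<rat>. 0 \<le> s \<longrightarrow> (AE \<omega> in M. (\<lambda>n. Z n s \<omega>) \<longlonglongrightarrow> \<zeta> s \<omega>)) \<and>
        (AE \<omega> in M. \<forall>t\<ge>0. ((\<lambda>s. \<zeta> s \<omega>) \<longlongrightarrow> L t \<omega>) (at t within \<rat> \<inter> {t<..})))"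

end

theory Submission
  imports Defs
begin

text \<open>
  Everything is deterministic: \<open>Y\<close> jumps from \<open>0\<close> to \<open>1\<close> at time \<open>1\<close>, and \<open>X n\<close> jumps
  from \<open>0\<close> to \<open>1\<close> slightly later, at a time decreasing to \<open>1\<close>.  A forward convex combination
  of the \<open>X n\<close> vanishes up to time \<open>1\<close> and equals \<open>1\<close> soon after, so taking right limits
  yields \<open>Y\<close>.  The integrand \<open>Y\<^sub>- = 1\<^bsub>(1,\<infinity>)\<^esub>\<close> is already \<open>1\<close> at the
  jumps of the \<open>X n\<close>, whose integrals therefore equal the integrators and have limit \<open>Y\<close>, but
  it is still \<open>0\<close> at the jump of \<open>Y\<close>, so the integral of \<open>Y\<^sub>-\<close> against \<open>Y\<close> is \<open>0\<close>.
\<close>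

section \<open>Step paths\<close>

text \<open>Convex combinations of unit jumps and the integrals against them all have this form. The
  index type is left free so that naturals index the elements of a hull and \<open>unit\<close>
  indexes a single jump.\<close>

definition step_path :: "'i set \<Rightarrow> ('i \<Rightarrow> real) \<Rightarrow> ('i \<Rightarrow> real) \<Rightarrow> real \<Rightarrow> real" where
  "step_path J u a t = (\<Sum>j\<in>J. u j * indicator {a j..} t)"

lemma step_path_eq_0: "(\<And>j. j \<in> J \<Longrightarrow> t < a j) \<Longrightarrow> step_path J u a t = 0"
  unfolding step_path_def by (intro sum.neutral) (auto simp: indicator_def dest: leD)

lemma step_path_eq_sum: "(\<And>j. j \<in> J \<Longrightarrow> a j \<le> t) \<Longrightarrow> step_path J u a t = sum u J"
  unfolding step_path_def by (intro sum.cong) auto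

lemma step_path_mono:
  assumes "\<And>j. j \<in> J \<Longrightarrow> 0 \<le> u j" "s \<le> t"
  shows "step_path J u a s \<le> step_path J u a t"
  unfolding step_path_def using assms
  by (intro sum_mono mult_left_mono) (auto simp: indicator_def)

lemma eventually_at_right_indicator_atLeast:
  "eventually (\<lambda>s. indicator {a..} s = (indicator {a..} t :: real)) (at_right (t::real))"
proof (cases "a \<le> t")
  case True
  then show ?thesis
    by (auto simp: eventually_at_filter indicator_def)
next
  case False
  then show ?thesis
    unfolding eventually_at_right_field by (intro exI[of _ a]) (auto simp: indicator_def)
qed

text \<open>At the jump time \<open>a\<close> the left limit is the value before the jump, so the
  closed half-line turns into the open one. This is how \<open>Y\<close> and its left-limit process
  come to differ at time 1.\<close>

lemma eventually_at_left_indicator_atLeast: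
  "eventually (\<lambda>s. indicator {a..} s = (indicator {a<..} t :: real)) (at_left (t::real))"
proof (cases "a < t")
  case True
  then show ?thesis
    unfolding eventually_at_left_field by (intro exI[of _ a]) (auto simp: indicator_def)
next
  case False
  then show ?thesis
    by (auto simp: eventually_at_filter indicator_def)
qed

text \<open>For t > 0 the left limit is decided on (0, t), so negative times never enter. This
  transfers path regularity along indistinguishability.\<close>

lemma cadlag_path_cong:
  assumes "\<And>t. 0 \<le> t \<Longrightarrow> x t = y t"
  shows "cadlag_path x \<longleftrightarrow> cadlag_path y"
proof -
  have "(x \<longlongrightarrow> l) (at_right t) \<longleftrightarrow> (y \<longlongrightarrow> l) (at_right t)" if "0 \<le> t" for t l
    using that assms by (intro tendsto_cong) (auto simp: eventually_at_filter)
  moreover have "(x \<longlongrightarrow> l) (at_left t) \<longleftrightarrow> (y \<longlongrightarrow> l) (at_left t)" if "0 < t" for t l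
    using that assms
    by (intro tendsto_cong) (auto simp: eventually_at_left_field intro!: exI[of _ 0])
  ultimately show ?thesis using assms by (auto simp: cadlag_path_def)
qed

lemma cadlag_path_indicator: "cadlag_path (indicator {a..})"
  unfolding cadlag_path_def
  using tendsto_eventually[OF eventually_at_right_indicator_atLeast]
    tendsto_eventually[OF eventually_at_left_indicator_atLeast] by blast

lemma cadlag_path_step_path: "cadlag_path (step_path J u a)"
proof -
  have "(step_path J u a \<longlongrightarrow> step_path J u a t) (at_right t)" if "0 \<le> t" for t
    unfolding step_path_def using that cadlag_path_indicator
    by (intro tendsto_intros) (auto simp: cadlag_path_def)
  moreover have "\<exists>l. (step_path J u a \<longlongrightarrow> l) (at_left t)" for t
  proof -
    have "(step_path J u a \<longlongrightarrow> (\<Sum>j\<in>J. u j * indicator {a j<..} t)) (at_left t)"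
      unfolding step_path_def
      by (intro tendsto_intros tendsto_eventually eventually_at_left_indicator_atLeast)
    then show ?thesis by blast
  qed
  ultimately show ?thesis by (auto simp: cadlag_path_def)
qed

lemma caglad_path_indicator: "caglad_path (indicator {a<..})"
proof -
  have "(indicator {a<..} \<longlongrightarrow> (indicator {a<..} t :: real)) (at_left t)" for t
  proof (rule tendsto_eventually, cases "a < t")
    case True
    then show "\<forall>\<^sub>F s in at_left t. indicator {a<..} s = (indicator {a<..} t :: real)"
      unfolding eventually_at_left_field by (intro exI[of _ a]) (auto simp: indicator_def)
  qed (auto simp: eventually_at_filter indicator_def)
  moreover have "(indicator {a<..} \<longlongrightarrow> (indicator {a..} t :: real)) (at_right t)" for t
  proof (rule tendsto_eventually, cases "a \<le> t")
    case False
    then show "\<forall>\<^sub>F s in at_right t. indicator {a<..} s = (indicator {a..} t :: real)"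
      unfolding eventually_at_right_field by (intro exI[of _ a]) (auto simp: indicator_def)
  qed (auto simp: eventually_at_filter indicator_def)
  ultimately show ?thesis by (auto simp: caglad_path_def)
qed

section \<open>Total variation\<close>

lemma path_var_cong:
  assumes "\<And>t. 0 \<le> t \<Longrightarrow> x t = y t"
  shows "path_var x t = path_var y t"
  unfolding path_var_def
  by (rule SUP_cong) (auto simp: assms intro!: sum.cong)

text \<open>Monotonicity removes the absolute values, and the increments over a partition telescope
  to \<open>x (p n) - x (p 0)\<close>.\<close>

lemma path_var_le_mono_on:
  assumes "mono_on {0..t} x" "0 \<le> t"
  shows "path_var x t \<le> ennreal (x t - x 0)"
  unfolding path_var_def
proof (rule SUP_least, clarify)
  fix n :: nat and p :: "nat \<Rightarrow> real"
  assume p: "\<forall>i\<le>n. p i \<in> {0..t}" and mono: "\<forall>i<n. p i \<le> p (Suc i)"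
  have x: "x r \<le> x s" if "0 \<le> r" "r \<le> s" "s \<le> t" for r s
    using that assms(1) by (auto simp: monotone_on_def)
  have "(\<Sum>i<n. ennreal \<bar>x (p (Suc i)) - x (p i)\<bar>) = (\<Sum>i<n. ennreal (x (p (Suc i)) - x (p i)))"
    using p mono by (intro sum.cong refl arg_cong[where f = ennreal] abs_of_nonneg) (auto intro!: x)
  also have "\<dots> = ennreal (\<Sum>i<n. x (p (Suc i)) - x (p i))"
    using p mono by (intro sum_ennreal) (auto intro!: x)
  also have "(\<Sum>i<n. x (p (Suc i)) - x (p i)) = x (p n) - x (p 0)"
    by (rule sum_lessThan_telescope)
  also have "ennreal (x (p n) - x (p 0)) \<le> ennreal (x t - x 0)"
    using p by (intro ennreal_leI diff_mono) (auto intro!: x)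
  finally show "(\<Sum>i<n. ennreal \<bar>x (p (Suc i)) - x (p i)\<bar>) \<le> ennreal (x t - x 0)" .
qed

lemma path_var_ge_increment:
  assumes "0 \<le> t"
  shows "ennreal \<bar>x t - x 0\<bar> \<le> path_var x t"
proof -
  \<comment> \<open>The partition with the two points 0 and t.\<close>
  have "(\<Sum>i<1. ennreal \<bar>x (if Suc i = 0 then 0 else t) - x (if i = 0 then 0 else t)\<bar>) \<le> path_var x t"
    unfolding path_var_def
    by (rule SUP_upper2[of "(1, \<lambda>i. if i = 0 then 0 else t)"]) (use assms in auto)
  then show ?thesis by simp
qed

text \<open>The monotone upper bound and the single-increment lower bound meet at 1 once t \<ge> a.
  Positivity of \<open>a\<close> makes the path start at 0, so that the jump counts.\<close>

lemma path_var_infinity_indicator: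
  assumes "0 < a"
  shows "path_var_infinity (indicator {a..}) = 1"
proof -
  have "path_var (indicator {a..}) t = 1" if "a \<le> t" for t
  proof (rule antisym)
    have "mono_on {0..t} (indicator {a..} :: real \<Rightarrow> real)"
      by (auto simp: monotone_on_def indicator_def)
    from path_var_le_mono_on[OF this] show "path_var (indicator {a..}) t \<le> 1"
      using assms that by (auto simp: indicator_def)
    show "1 \<le> path_var (indicator {a..}) t"
      using path_var_ge_increment[of t "indicator {a..}"] assms that by (auto simp: indicator_def)
  qed
  then have "(path_var (indicator {a..}) \<longlongrightarrow> 1) at_top"
    by (intro tendsto_eventually eventually_at_top_linorderI)
  then show ?thesis
    unfolding path_var_infinity_def by (intro tendsto_Lim) auto
qed

section \<open>One-sided continuity and rational times\<close>

text \<open>Exceeding \<epsilon> is an open condition, so it persists to the right of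
  \<open>r\<close> and reaches a rational. The end point \<open>s\<close> is adjoined because
  nothing to its right belongs to the interval. Suprema over an interval thereby become
  countable.\<close>

lemma right_continuous_exceeds_at_rational:
  fixes g :: "real \<Rightarrow> real"
  assumes g: "\<And>t. 0 \<le> t \<Longrightarrow> (g \<longlongrightarrow> g t) (at_right t)"
    and r: "0 \<le> r" "r \<le> s" "\<epsilon> < \<bar>g r\<bar>"
  shows "\<exists>q\<in>{0..s} \<inter> (\<rat> \<union> {s}). \<epsilon> < \<bar>g q\<bar>"
proof (cases "r = s")
  case False
  then have "r < s" using r by simp
  have "\<forall>\<^sub>F q in at_right r. \<epsilon> < \<bar>g q\<bar>"
    using tendsto_rabs[OF g[OF r(1)]] r(3) by (rule order_tendstoD)
  then obtain b where b: "r < b" "\<And>q. r < q \<Longrightarrow> q < b \<Longrightarrow> \<epsilon> < \<bar>g q\<bar>"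
    unfolding eventually_at_right_field by blast
  obtain q where "q \<in> \<rat>" "r < q" "q < min b s"
    using Rats_dense_in_real[of r "min b s"] b \<open>r < s\<close> by auto
  then show ?thesis using b r by (intro bexI[of _ q]) auto
qed (use r in auto)

text \<open>The mirror image for left-continuous paths. The exceptional end point is now 0, which is
  itself rational.\<close>

lemma left_continuous_exceeds_at_rational:
  fixes g :: "real \<Rightarrow> real"
  assumes g: "\<And>t. 0 < t \<Longrightarrow> (g \<longlongrightarrow> g t) (at_left t)"
    and r: "0 \<le> r" "r \<le> s" "\<epsilon> < \<bar>g r\<bar>"
  shows "\<exists>q\<in>{0..s} \<inter> \<rat>. \<epsilon> < \<bar>g q\<bar>"
proof (cases "r = 0")
  case False
  then have "0 < r" using r by simp
  have "\<forall>\<^sub>F q in at_left r. \<epsilon> < \<bar>g q\<bar>"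
    using tendsto_rabs[OF g[OF \<open>0 < r\<close>]] r(3) by (rule order_tendstoD)
  then obtain b where b: "b < r" "\<And>q. b < q \<Longrightarrow> q < r \<Longrightarrow> \<epsilon> < \<bar>g q\<bar>"
    unfolding eventually_at_left_field by blast
  obtain q where "q \<in> \<rat>" "max b 0 < q" "q < r"
    using Rats_dense_in_real[of "max b 0" r] b \<open>0 < r\<close> by auto
  then show ?thesis using b r by (intro bexI[of _ q]) auto
qed (use r in auto)

text \<open>Simple predictable integrands are built from such half-open intervals, which is what
  makes them left-continuous.\<close>

lemma indicator_left_continuous:
  "((\<lambda>s. indicator {b<..c} s :: real) \<longlongrightarrow> indicator {b<..c} t) (at_left (t::real))"
proof (rule tendsto_eventually)
  consider "t \<le> b" | "b < t" "t \<le> c" | "c < t" by linarith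
  then show "\<forall>\<^sub>F s in at_left t. indicator {b<..c} s = (indicator {b<..c} t :: real)"
  proof cases
    case 2
    then show ?thesis
      unfolding eventually_at_left_field by (intro exI[of _ b]) (auto simp: indicator_def)
  next
    case 3
    then show ?thesis
      unfolding eventually_at_left_field by (intro exI[of _ c]) (auto simp: indicator_def)
  qed (auto simp: eventually_at_filter indicator_def)
qed

section \<open>Processes with deterministic paths\<close>

lemma indistinguishable_trans:
  "indistinguishable M X Y \<Longrightarrow> indistinguishable M Y Z \<Longrightarrow> indistinguishable M X Z"
  unfolding indistinguishable_def by (auto elim: AE_mp)

context stochastic_basis
begin

lemma adapted_deterministic: "adapted F (\<lambda>t \<omega>. x t)"
  by (simp add: adapted_def)

lemma null_sets_subset_F:
  assumes "0 \<le> t"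
  shows "null_sets M \<subseteq> sets (F t)"
  using sets_F_mono[OF assms] sets_F_0 by auto

text \<open>Each preimage either lies in the null set where f \<noteq> c or has its complement
  there. By completeness all subsets of that set are null, and the null sets already belong to
  \<open>F 0\<close>.\<close>

lemma borel_measurable_F_AE_const:
  fixes f :: "'a \<Rightarrow> real"
  assumes "AE \<omega> in M. f \<omega> = c" "0 \<le> t"
  shows "f \<in> borel_measurable (F t)"
proof (rule borel_measurableI)
  fix S :: "real set"
  have sp: "space (F t) = space M" by (rule space_F)
  have null: "A \<in> sets (F t)" if "A \<subseteq> {\<omega> \<in> space M. f \<omega> \<noteq> c}" for A
    using complete2[OF that] assms(1) null_sets_subset_F[OF assms(2)] by (auto simp: AE_iff_null_sets)
  show "f -` S \<inter> space (F t) \<in> sets (F t)"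
  proof (cases "c \<in> S")
    case True
    have "space (F t) - {\<omega> \<in> space M. f \<omega> \<notin> S} \<in> sets (F t)"
      using True by (intro sets.compl_sets null) auto
    also have "space (F t) - {\<omega> \<in> space M. f \<omega> \<notin> S} = f -` S \<inter> space (F t)"
      by (auto simp: sp)
    finally show ?thesis .
  next
    case False
    then show ?thesis by (intro null) (auto simp: sp)
  qed
qed

text \<open>Members of \<open>process_hull\<close> are deterministic only up to a null set, so their
  adaptedness relies on the null sets contained in the filtration.\<close>

lemma adapted_indistinguishable_deterministic:
  assumes "indistinguishable M X (\<lambda>t \<omega>. x t)"
  shows "adapted F X"
  unfolding adapted_def
proof safe
  fix t :: real assume "0 \<le> t"
  then have "AE \<omega> in M. X t \<omega> = x t"
    using assms by (auto simp: indistinguishable_def elim: AE_mp)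
  then show "X t \<in> borel_measurable (F t)"
    using \<open>0 \<le> t\<close> by (rule borel_measurable_F_AE_const)
qed

text \<open>Supplies the martingale part for semimartingales of finite variation; the constant times
  \<open>n\<close> localise.\<close>

lemma local_martingale_0: "local_martingale M F (\<lambda>t \<omega>. 0)"
proof -
  have "AE \<omega> in M. real_cond_exp M (F s) (\<lambda>\<omega>. 0) \<omega> = 0" if "0 \<le> s" for s
  proof -
    interpret finite_measure_subalgebra M "F s"
      using subalg[OF that] by unfold_locales
    show ?thesis by (rule real_cond_exp_F_meas) auto
  qed
  then have "martingale M F (\<lambda>t \<omega>. 0)"
    by (auto simp: martingale_def adapted_def)
  moreover have "cadlag M (\<lambda>t \<omega>. 0)"
    by (auto simp: cadlag_def cadlag_path_def)
  moreover have "finite_stopping_time M F (\<lambda>\<omega>. real n)" for n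
    by (simp add: finite_stopping_time_def stopping_time_const)
  moreover have "incseq real" "filterlim real at_top sequentially"
    by (auto simp: incseq_def filterlim_real_sequentially)
  ultimately show ?thesis
    unfolding local_martingale_def adapted_def
    by (intro conjI exI[of _ "\<lambda>n \<omega>. real n"]) auto
qed

text \<open>Nonnegative weights make the path monotone, hence of finite variation, and
  \<open>X\<close> decomposes as 0 + \<open>X\<close>.\<close>

lemma semimartingale_indistinguishable_step_path:
  assumes X: "indistinguishable M X (\<lambda>t \<omega>. step_path J u a t)"
    and u: "\<And>j. j \<in> J \<Longrightarrow> 0 \<le> u j"
  shows "semimartingale M F X"
proof -
  have ad: "adapted F X" using X by (rule adapted_indistinguishable_deterministic)
  have eq: "AE \<omega> in M. \<forall>t\<ge>0. X t \<omega> = step_path J u a t"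
    using X by (simp add: indistinguishable_def)
  then have "AE \<omega> in M. cadlag_path (\<lambda>t. X t \<omega>)"
  proof eventually_elim
    case (elim \<omega>)
    then show ?case using cadlag_path_cong[of "\<lambda>t. X t \<omega>" "step_path J u a"] cadlag_path_step_path by blast
  qed
  then have cad: "cadlag M X" by (simp add: cadlag_def)
  have var: "path_var (step_path J u a) t < \<infinity>" if "0 \<le> t" for t
  proof -
    have "path_var (step_path J u a) t \<le> ennreal (step_path J u a t - step_path J u a 0)"
      using that u by (intro path_var_le_mono_on) (auto simp: monotone_on_def intro!: step_path_mono)
    then show ?thesis using ennreal_less_top le_less_trans by (metis infinity_ennreal_def)
  qed
  have "AE \<omega> in M. \<forall>t\<ge>0. path_var (\<lambda>s. X s \<omega>) t < \<infinity>"
    using eq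
  proof eventually_elim
    case (elim \<omega>)
    then show ?case using path_var_cong[of "\<lambda>s. X s \<omega>" "step_path J u a"] var by auto
  qed
  then have "finite_variation M F X"
    using ad cad by (simp add: finite_variation_def)
  then show ?thesis
    unfolding semimartingale_def using ad cad local_martingale_0
    by (intro conjI exI[of _ "\<lambda>t \<omega>. 0"] exI[of _ X]) (auto simp: indistinguishable_def)
qed

section \<open>Integrals against step paths\<close>

lemma borel_measurable_F_imp_M:
  assumes "0 \<le> t" "f \<in> borel_measurable (F t)"
  shows "f \<in> borel_measurable M"
  using measurable_from_subalg[OF subalg[OF assms(1)] assms(2)] .

lemma finite_stopping_time_borel_measurable:
  assumes "finite_stopping_time M F T"
  shows "T \<in> borel_measurable M"
proof (rule borel_measurableI_le)
  fix t :: real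
  show "{\<omega> \<in> space M. T \<omega> \<le> t} \<in> sets M"
  proof (cases "0 \<le> t")
    case True
    have "{\<omega> \<in> space M. T \<omega> \<le> t} \<in> sets (F t)"
      using assms by (auto simp: finite_stopping_time_def stopping_time_def pred_def space_F)
    then show ?thesis using subalg[OF True] by (auto simp: subalgebra_def)
  next
    \<comment> \<open>\<open>subalg\<close> speaks only of t \<ge> 0; for negative t the event is
      empty because \<open>T\<close> is nonnegative.\<close>
    case False
    then have "{\<omega> \<in> space M. T \<omega> \<le> t} = {}"
      using assms by (force simp: finite_stopping_time_def)
    then show ?thesis by (simp only: sets.empty_sets)
  qed
qed

text \<open>Since \<open>T\<close> is finite, a set \<open>A\<close> of the stopped \<sigma>-algebra
  is the union of its parts where T \<le> n, each of which lies in \<open>F n\<close>.\<close>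

lemma borel_measurable_pre_sigma_imp_M:
  fixes h :: "'a \<Rightarrow> real"
  assumes T: "finite_stopping_time M F T" and h: "h \<in> borel_measurable (pre_sigma T)"
  shows "h \<in> borel_measurable M"
proof (rule measurableI)
  fix B :: "real set" assume "B \<in> sets borel"
  define A where "A = h -` B \<inter> space M"
  have "A \<in> sets (pre_sigma T)"
    using measurable_sets[OF h \<open>B \<in> sets borel\<close>] by (simp add: A_def space_pre_sigma)
  then have "{\<omega>\<in>A. T \<omega> \<le> real n} \<in> sets M" for n
    using sets_pre_sigmaD[of T A "real n"] T subalg[of "real n"]
    by (auto simp: finite_stopping_time_def subalgebra_def)
  then have "(\<Union>n. {\<omega>\<in>A. T \<omega> \<le> real n}) \<in> sets M" by blast
  also have "(\<Union>n. {\<omega>\<in>A. T \<omega> \<le> real n}) = A"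
    using real_arch_simple by blast
  finally show "h -` B \<inter> space M \<in> sets M" by (simp add: A_def)
qed auto

text \<open>Left-continuity reduces the uncountable union to rational times. Measurability is needed
  because probabilities of such events serve as upper bounds, while \<open>measure\<close> is 0 on
  nonmeasurable sets.\<close>

lemma elementary_integrand_measurable_exceedance:
  assumes "elementary_integral M F X H J"
    and x: "\<And>t. 0 < t \<Longrightarrow> (x \<longlongrightarrow> x t) (at_left t)"
  shows "{\<omega> \<in> space M. \<exists>s\<in>{0..t}. \<bar>H s \<omega> - x s\<bar> > \<epsilon>} \<in> sets M"
proof -
  obtain k T h0 h where
    T: "\<And>i. i \<le> k \<Longrightarrow> finite_stopping_time M F (T i)" and
    h0: "h0 \<in> borel_measurable (F 0)" and
    h: "\<And>i. i < k \<Longrightarrow> h i \<in> borel_measurable (pre_sigma (T i))" and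
    H: "H = (\<lambda>t \<omega>. h0 \<omega> * indicator {0} t + (\<Sum>i<k. h i \<omega> * indicator {T i \<omega><..T (Suc i) \<omega>} t))"
    using assms(1) unfolding elementary_integral_def by auto
  have [measurable]: "H s \<in> borel_measurable M" for s
  proof -
    have "h0 \<in> borel_measurable M"
      using h0 by (intro borel_measurable_F_imp_M[of 0]) auto
    moreover have "(\<lambda>\<omega>. h i \<omega> * indicator {T i \<omega><..T (Suc i) \<omega>} s) \<in> borel_measurable M"
      if "i < k" for i
    proof -
      have [measurable]: "T i \<in> borel_measurable M" "T (Suc i) \<in> borel_measurable M"
        using that by (auto intro!: finite_stopping_time_borel_measurable T)
      have [measurable]: "h i \<in> borel_measurable M"
        using that by (intro borel_measurable_pre_sigma_imp_M[OF T h]) auto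
      have "(\<lambda>\<omega>. h i \<omega> * indicator {T i \<omega><..T (Suc i) \<omega>} s) =
        (\<lambda>\<omega>. h i \<omega> * (if T i \<omega> < s \<and> s \<le> T (Suc i) \<omega> then 1 else 0))"
        by (auto simp: indicator_def)
      then show ?thesis by simp
    qed
    ultimately show ?thesis unfolding H by (intro borel_measurable_add borel_measurable_sum) auto
  qed
  have left: "((\<lambda>s. H s \<omega> - x s) \<longlongrightarrow> H s \<omega> - x s) (at_left s)" if "0 < s" for s \<omega>
  proof -
    have "((\<lambda>r. indicator {0} r :: real) \<longlongrightarrow> indicator {0} s) (at_left s)"
      using that by (intro tendsto_eventually) (auto simp: eventually_at_left_field intro!: exI[of _ 0])
    then show ?thesis
      unfolding H using x[OF that] by (intro tendsto_intros indicator_left_continuous)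
  qed
  have "{\<omega> \<in> space M. \<exists>s\<in>{0..t}. \<bar>H s \<omega> - x s\<bar> > \<epsilon>} =
    (\<Union>s\<in>{0..t} \<inter> \<rat>. {\<omega> \<in> space M. \<bar>H s \<omega> - x s\<bar> > \<epsilon>})"
  proof (intro set_eqI iffI)
    fix \<omega> assume "\<omega> \<in> {\<omega> \<in> space M. \<exists>s\<in>{0..t}. \<bar>H s \<omega> - x s\<bar> > \<epsilon>}"
    then show "\<omega> \<in> (\<Union>s\<in>{0..t} \<inter> \<rat>. {\<omega> \<in> space M. \<bar>H s \<omega> - x s\<bar> > \<epsilon>})"
      using left_continuous_exceeds_at_rational[OF left, of _ t \<epsilon> \<omega>] by fastforce
  qed auto
  also have "\<dots> \<in> sets M"
    by (intro sets.countable_UN' countable_Int2 countable_rat) auto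
  finally show ?thesis .
qed

text \<open>A unit jump at \<open>a j\<close> is seen only by the interval containing
  \<open>a j\<close>, where it picks up the value of \<open>H\<close>. The elementary integral is
  thus the pathwise sum over the jumps.\<close>

lemma elementary_integral_step_path:
  assumes J: "elementary_integral M F X H J"
    and X: "indistinguishable M X (\<lambda>t \<omega>. step_path K u a t)"
    and a: "\<And>j. j \<in> K \<Longrightarrow> 0 < a j"
  shows "indistinguishable M J (\<lambda>t \<omega>. step_path K (\<lambda>j. u j * H (a j) \<omega>) a t)"
proof -
  obtain k T h0 h where
    T: "\<And>i. i \<le> k \<Longrightarrow> finite_stopping_time M F (T i)" and
    le: "\<And>i \<omega>. i < k \<Longrightarrow> \<omega> \<in> space M \<Longrightarrow> T i \<omega> \<le> T (Suc i) \<omega>" and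
    H: "H = (\<lambda>t \<omega>. h0 \<omega> * indicator {0} t + (\<Sum>i<k. h i \<omega> * indicator {T i \<omega><..T (Suc i) \<omega>} t))" and
    J: "J = (\<lambda>t \<omega>. \<Sum>i<k. h i \<omega> * (X (min t (T (Suc i) \<omega>)) \<omega> - X (min t (T i \<omega>)) \<omega>))"
    using J unfolding elementary_integral_def by blast
  have "AE \<omega> in M. \<forall>t\<ge>0. X t \<omega> = step_path K u a t"
    using X by (simp add: indistinguishable_def)
  then have "AE \<omega> in M. \<forall>t\<ge>0. J t \<omega> = step_path K (\<lambda>j. u j * H (a j) \<omega>) a t"
    using AE_space
  proof eventually_elim
    case (elim \<omega>)
    have T0: "0 \<le> T i \<omega>" if "i \<le> k" for i
      using T[OF that] elim by (auto simp: finite_stopping_time_def)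
    show ?case
    proof safe
      fix t :: real assume "0 \<le> t"
      have "J t \<omega> = (\<Sum>i<k. h i \<omega> * (step_path K u a (min t (T (Suc i) \<omega>)) - step_path K u a (min t (T i \<omega>))))"
        unfolding J using elim(1) T0 \<open>0 \<le> t\<close> by (intro sum.cong) auto
      also have "\<dots> = (\<Sum>i<k. \<Sum>j\<in>K. u j * (h i \<omega> * indicator {T i \<omega><..T (Suc i) \<omega>} (a j)) * indicator {a j..} t)"
      proof (intro sum.cong refl)
        fix i assume "i \<in> {..<k}"
        then have "T i \<omega> \<le> T (Suc i) \<omega>" using le elim by auto
        \<comment> \<open>The stopped unit jump increases over the interval exactly when
          \<open>a j\<close> lies in it and a j \<le> t.\<close>
        then have ind: "indicator {a j..} (min t (T (Suc i) \<omega>)) - indicator {a j..} (min t (T i \<omega>)) =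
          (indicator {T i \<omega><..T (Suc i) \<omega>} (a j) * indicator {a j..} t :: real)" for j
          by (auto simp: indicator_def)
        show "h i \<omega> * (step_path K u a (min t (T (Suc i) \<omega>)) - step_path K u a (min t (T i \<omega>))) =
          (\<Sum>j\<in>K. u j * (h i \<omega> * indicator {T i \<omega><..T (Suc i) \<omega>} (a j)) * indicator {a j..} t)"
          unfolding step_path_def sum_subtractf[symmetric] right_diff_distrib[symmetric] ind
          by (simp add: sum_distrib_left mult_ac)
      qed
      also have "\<dots> = (\<Sum>j\<in>K. u j * (\<Sum>i<k. h i \<omega> * indicator {T i \<omega><..T (Suc i) \<omega>} (a j)) * indicator {a j..} t)"
        by (subst sum.swap) (simp only: sum_distrib_left sum_distrib_right)
      also have "\<dots> = step_path K (\<lambda>j. u j * H (a j) \<omega>) a t"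
        proof -
        \<comment> \<open>Jumps at positive times do not meet the term with \<open>h0\<close>, so
          the inner sum is all of \<open>H (a j) \<omega>\<close>.\<close>
        have "a j \<noteq> 0" if "j \<in> K" for j using a[OF that] by simp
        then show ?thesis unfolding step_path_def H by (intro sum.cong) auto
      qed
      finally show "J t \<omega> = step_path K (\<lambda>j. u j * H (a j) \<omega>) a t" .
    qed
  qed
  then show ?thesis by (simp add: indistinguishable_def)
qed

text \<open>The error of the integral is a convex combination of errors of the integrand at jump
  times up to \<open>s\<close>. A uniform bound \<epsilon> on the integrands over [0, t] therefore
  passes unchanged to the integrals, and ucp convergence with it.\<close>

lemma is_ito_integral_step_path:
  assumes X: "indistinguishable M X (\<lambda>t \<omega>. step_path K u a t)"
    and a: "\<And>j. j \<in> K \<Longrightarrow> 0 < a j" and u: "\<And>j. j \<in> K \<Longrightarrow> 0 \<le> u j" "sum u K = 1"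
    and x: "caglad_path x"
  shows "is_ito_integral M F (\<lambda>t \<omega>. x t) X (\<lambda>t \<omega>. step_path K (\<lambda>j. u j * x (a j)) a t)"
  unfolding is_ito_integral_def
proof (intro conjI allI impI)
  show "adapted F (\<lambda>t \<omega>. x t)" "adapted F (\<lambda>t \<omega>. step_path K (\<lambda>j. u j * x (a j)) a t)"
    by (rule adapted_deterministic)+
  show "caglad M (\<lambda>t \<omega>. x t)" using x by (simp add: caglad_def)
  show "semimartingale M F X"
    using X u(1) by (rule semimartingale_indistinguishable_step_path)
  show "cadlag M (\<lambda>t \<omega>. step_path K (\<lambda>j. u j * x (a j)) a t)"
    using cadlag_path_step_path by (simp add: cadlag_def)
next
  fix Hs Js :: "nat \<Rightarrow> 'a process"
  assume el: "\<forall>n. elementary_integral M F X (Hs n) (Js n)"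
    and ucp: "ucp_tendsto M Hs (\<lambda>t \<omega>. x t)"
  show "ucp_tendsto M Js (\<lambda>t \<omega>. step_path K (\<lambda>j. u j * x (a j)) a t)"
    unfolding ucp_tendsto_def
  proof (intro allI impI)
    fix t \<epsilon> :: real assume t: "0 \<le> t" and "0 < \<epsilon>"
    let ?A = "\<lambda>n. {\<omega> \<in> space M. \<exists>s\<in>{0..t}. \<bar>Js n s \<omega> - step_path K (\<lambda>j. u j * x (a j)) a s\<bar> > \<epsilon>}"
    let ?B = "\<lambda>n. {\<omega> \<in> space M. \<exists>s\<in>{0..t}. \<bar>Hs n s \<omega> - x s\<bar> > \<epsilon>}"
    have le: "measure M (?A n) \<le> measure M (?B n)" for n
    proof (rule finite_measure_mono_AE)
      \<comment> \<open>Only the dominating event has to be measurable for this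
        monotonicity.\<close>
      show "?B n \<in> sets M"
        using el x by (intro elementary_integrand_measurable_exceedance) (auto simp: caglad_path_def)
      have "AE \<omega> in M. \<forall>s\<ge>0. Js n s \<omega> = step_path K (\<lambda>j. u j * Hs n (a j) \<omega>) a s"
        using elementary_integral_step_path[OF el[rule_format] X a] by (simp add: indistinguishable_def)
      then show "AE \<omega> in M. \<omega> \<in> ?A n \<longrightarrow> \<omega> \<in> ?B n"
      proof eventually_elim
        case (elim \<omega>)
        show ?case
        proof (rule impI, rule ccontr)
          assume A: "\<omega> \<in> ?A n" and B: "\<omega> \<notin> ?B n"
          have small: "\<bar>Hs n s \<omega> - x s\<bar> \<le> \<epsilon>" if "0 \<le> s" "s \<le> t" for s
            using A B that by force
          obtain s where s: "0 \<le> s" "s \<le> t" "\<epsilon> < \<bar>Js n s \<omega> - step_path K (\<lambda>j. u j * x (a j)) a s\<bar>"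
            using A by auto
          have "Js n s \<omega> - step_path K (\<lambda>j. u j * x (a j)) a s =
            (\<Sum>j\<in>K. u j * ((Hs n (a j) \<omega> - x (a j)) * indicator {a j..} s))"
            using elim s by (simp add: step_path_def sum_subtractf[symmetric] algebra_simps)
          also have "\<bar>\<dots>\<bar> \<le> (\<Sum>j\<in>K. u j * \<epsilon>)"
          proof (rule sum_abs[THEN order_trans], rule sum_mono)
            \<comment> \<open>A jump after \<open>s\<close> contributes 0; any other satisfies 0 < a
              j \<le> s \<le> t, where \<open>small\<close> applies.\<close>
            fix j assume j: "j \<in> K"
            show "\<bar>u j * ((Hs n (a j) \<omega> - x (a j)) * indicator {a j..} s)\<bar> \<le> u j * \<epsilon>"
              using small[of "a j"] a[OF j] u(1)[OF j] s \<open>0 < \<epsilon>\<close>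
              by (auto simp: abs_mult indicator_def intro!: mult_left_mono)
          qed
          also have "\<dots> = \<epsilon>" by (simp add: sum_distrib_right[symmetric] u)
          finally show False using s by simp
        qed
      qed
    qed
    have lim: "(\<lambda>n. measure M (?B n)) \<longlonglongrightarrow> 0"
      using ucp t \<open>0 < \<epsilon>\<close> by (simp add: ucp_tendsto_def)
    show "(\<lambda>n. measure M (?A n)) \<longlonglongrightarrow> 0"
      by (rule tendsto_sandwich[OF always_eventually always_eventually tendsto_const lim])
        (intro allI measure_nonneg le)+
  qed
qed

text \<open>For n \<ge> s the deviation events on [0, s] agree almost surely with one fixed event,
  so their probabilities are constant. They also tend to 0, hence that event is null. Rational times
  and the bounds 1/(k+1) leave countably many null sets, and right-continuity covers the remaining
  times.\<close>

lemma ucp_limit_eventually_deterministic: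
  assumes Z: "adapted F Z" "cadlag M Z" and x: "cadlag_path x"
    and J: "\<And>n. AE \<omega> in M. \<forall>s. 0 \<le> s \<longrightarrow> s \<le> real n \<longrightarrow> J n s \<omega> = x s"
    and ucp: "ucp_tendsto M J Z"
  shows "indistinguishable M Z (\<lambda>t \<omega>. x t)"
proof -
  have [measurable]: "Z t \<in> borel_measurable M" if "0 \<le> t" for t
    using Z(1) that by (auto simp: adapted_def intro: borel_measurable_F_imp_M)
  have rc: "AE \<omega> in M. \<forall>t\<ge>0. ((\<lambda>t. x t - Z t \<omega>) \<longlongrightarrow> x t - Z t \<omega>) (at_right t)"
    using Z(2) unfolding cadlag_def
    by eventually_elim (use x in \<open>auto simp: cadlag_path_def intro!: tendsto_diff\<close>)
  have bound: "AE \<omega> in M. \<bar>x s - Z s \<omega>\<bar> \<le> \<epsilon>" if s: "0 \<le> s" and "0 < \<epsilon>" for s \<epsilon>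
  proof -
    let ?D = "{0..s} \<inter> (\<rat> \<union> {s})"
    let ?B = "\<Union>r\<in>?D. {\<omega> \<in> space M. \<bar>x r - Z r \<omega>\<bar> > \<epsilon>}"
    let ?S = "\<lambda>n. {\<omega> \<in> space M. \<exists>r\<in>{0..s}. \<bar>J n r \<omega> - Z r \<omega>\<bar> > \<epsilon>}"
    have B: "?B \<in> sets M"
      by (intro sets.countable_UN' countable_Int2 countable_Un countable_rat) auto
    have stable: "measure M (?S n) = measure M ?B" if n: "s \<le> real n" for n
    proof -
      have ae: "AE \<omega> in M. \<omega> \<in> ?B \<longleftrightarrow> \<omega> \<in> ?S n"
        using rc J[of n] AE_space
      proof eventually_elim
        case (elim \<omega>)
        have eq: "J n r \<omega> = x r" if "r \<in> {0..s}" for r using elim n that by auto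
        show ?case
        proof
          assume "\<omega> \<in> ?B"
          then show "\<omega> \<in> ?S n" using eq by auto
        next
          assume "\<omega> \<in> ?S n"
          then obtain r where r: "0 \<le> r" "r \<le> s" "\<epsilon> < \<bar>x r - Z r \<omega>\<bar>" using eq by auto
          then have "\<exists>q\<in>?D. \<epsilon> < \<bar>x q - Z q \<omega>\<bar>"
            using elim by (intro right_continuous_exceeds_at_rational[of "\<lambda>t. x t - Z t \<omega>"]) auto
          then show "\<omega> \<in> ?B" using elim by auto
        qed
      qed
      \<comment> \<open>Nothing is assumed about measurability of \<open>J n\<close>; it is
        inherited from \<open>?B\<close> through completeness.\<close>
      have "?S n \<in> sets M" using in_sets_AE[OF ae B] by blast
      then show ?thesis using ae B by (intro measure_eq_AE) auto
    qed
    have "\<forall>\<^sub>F n in sequentially. measure M (?S n) = measure M ?B"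
    proof (rule eventually_sequentiallyI)
      fix n assume "nat \<lceil>s\<rceil> \<le> n"
      then have "s \<le> real n" by linarith
      then show "measure M (?S n) = measure M ?B" by (rule stable)
    qed
    then have "(\<lambda>n. measure M (?S n)) \<longlonglongrightarrow> measure M ?B" by (rule tendsto_eventually)
    moreover have "(\<lambda>n. measure M (?S n)) \<longlonglongrightarrow> 0"
      using ucp s \<open>0 < \<epsilon>\<close> by (simp add: ucp_tendsto_def)
    ultimately have "measure M ?B = 0" by (rule LIMSEQ_unique)
    then have "?B \<in> null_sets M" using B by (simp add: null_sets_def emeasure_eq_measure)
    then have "AE \<omega> in M. \<omega> \<notin> ?B" by (rule AE_not_in)
    then show ?thesis using AE_space
    proof eventually_elim
      case (elim \<omega>)
      then show ?case using s by (force simp: not_le)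
    qed
  qed
  have "AE \<omega> in M. \<forall>q\<in>\<rat> \<inter> {0..}. \<forall>k::nat. \<bar>x q - Z q \<omega>\<bar> \<le> inverse (real (Suc k))"
    by (subst AE_ball_countable) (auto simp: countable_rat AE_all_countable intro!: bound)
  then have "AE \<omega> in M. \<forall>t\<ge>0. Z t \<omega> = x t"
    using rc
  proof eventually_elim
    case (elim \<omega>)
    have q0: "x q - Z q \<omega> = 0" if q: "q \<in> \<rat>" "0 \<le> q" for q
    proof (rule ccontr)
      assume "x q - Z q \<omega> \<noteq> 0"
      then obtain k where "inverse (real (Suc k)) < \<bar>x q - Z q \<omega>\<bar>"
        using reals_Archimedean[of "\<bar>x q - Z q \<omega>\<bar>"] by auto
      then show False using elim(1) q by (meson IntI atLeast_iff not_le)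
    qed
    show ?case
    proof (intro allI impI, rule ccontr)
      fix t :: real assume t: "0 \<le> t" "Z t \<omega> \<noteq> x t"
      \<comment> \<open>With a rational horizon \<open>s\<close>, the adjoined end point is covered
        by \<open>q0\<close> as well.\<close>
      have "\<exists>s\<in>\<rat>. t \<le> s" using Rats_dense_in_real[of t "t + 1"] by (auto intro: less_imp_le)
      then obtain s where s: "s \<in> \<rat>" "t \<le> s" by blast
      have "\<exists>q\<in>{0..s} \<inter> (\<rat> \<union> {s}). 0 < \<bar>x q - Z q \<omega>\<bar>"
        using elim(2) t s by (intro right_continuous_exceeds_at_rational[of "\<lambda>t. x t - Z t \<omega>" t]) auto
      then show False using q0 s by auto
    qed
  qed
  then show ?thesis by (simp add: indistinguishable_def)
qed

text \<open>
  For this integrand the elementary approximations can be taken to agree with it up to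
  time \<open>n\<close>, so their integrals stabilise and determine the integral.
\<close>

lemma is_ito_integral_indicator_unique:
  assumes Z: "is_ito_integral M F (\<lambda>t \<omega>. indicator {1<..} t) X Z"
    and X: "indistinguishable M X (\<lambda>t \<omega>. step_path K u a t)"
    and a: "\<And>j. j \<in> K \<Longrightarrow> 0 < a j"
  shows "indistinguishable M Z (\<lambda>t \<omega>. step_path K (\<lambda>j. u j * indicator {1<..} (a j)) a t)"
proof -
  \<comment> \<open>The approximating integrand lives on the single interval from 1 to
    \<open>N n\<close>; the maximum keeps its end points ordered when n = 0.\<close>
  define N :: "nat \<Rightarrow> real" where "N n = max 1 (real n)" for n
  define H :: "nat \<Rightarrow> 'a process" where "H n = (\<lambda>t \<omega>. indicator {1<..N n} t)" for n
  define J :: "nat \<Rightarrow> 'a process" where "J n = (\<lambda>t \<omega>. X (min t (N n)) \<omega> - X (min t 1) \<omega>)" for n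
  have el: "elementary_integral M F X (H n) (J n)" for n
    unfolding elementary_integral_def
    by (intro exI[of _ "1::nat"] exI[of _ "\<lambda>i \<omega>. if i = 0 then 1 else N n"] exI[of _ "\<lambda>\<omega>. 0"]
        exI[of _ "\<lambda>i \<omega>. 1"])
      (auto simp: finite_stopping_time_def stopping_time_const N_def H_def J_def)
  have "ucp_tendsto M H (\<lambda>t \<omega>. indicator {1<..} t)"
    unfolding ucp_tendsto_def
  proof (intro allI impI tendsto_eventually)
    fix t \<epsilon> :: real assume "0 \<le> t" "0 < \<epsilon>"
    show "\<forall>\<^sub>F n in sequentially. measure M {\<omega> \<in> space M. \<exists>s\<in>{0..t}. \<epsilon> < \<bar>H n s \<omega> - indicator {1<..} s\<bar>} = 0"
      using eventually_ge_at_top[of "nat \<lceil>t\<rceil>"]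
    proof eventually_elim
      case (elim n)
      then have "t \<le> real n" by linarith
      then have "H n s \<omega> = indicator {1<..} s" if "s \<le> t" for s \<omega>
        using that by (auto simp: H_def N_def indicator_def)
      then have "{\<omega> \<in> space M. \<exists>s\<in>{0..t}. \<epsilon> < \<bar>H n s \<omega> - indicator {1<..} s\<bar>} = {}"
        using \<open>0 < \<epsilon>\<close> by auto
      then show ?case by (simp only: measure_empty)
    qed
  qed
  then have ucp: "ucp_tendsto M J Z"
    using Z el by (auto simp: is_ito_integral_def)
  show ?thesis
  proof (rule ucp_limit_eventually_deterministic[OF _ _ _ _ ucp])
    show "adapted F Z" "cadlag M Z" using Z by (auto simp: is_ito_integral_def)
    show "cadlag_path (step_path K (\<lambda>j. u j * indicator {1<..} (a j)) a)"
      by (rule cadlag_path_step_path)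
    fix n
    have "AE \<omega> in M. \<forall>s\<ge>0. J n s \<omega> = step_path K (\<lambda>j. u j * H n (a j) \<omega>) a s"
      using elementary_integral_step_path[OF el X a] by (simp add: indistinguishable_def)
    then show "AE \<omega> in M. \<forall>s. 0 \<le> s \<longrightarrow> s \<le> real n \<longrightarrow>
        J n s \<omega> = step_path K (\<lambda>j. u j * indicator {1<..} (a j)) a s"
    proof eventually_elim
      case (elim \<omega>)
      \<comment> \<open>Only jumps with a j \<le> s \<le> n contribute, and there \<open>H n\<close>
        equals the full indicator.\<close>
      have "step_path K (\<lambda>j. u j * H n (a j) \<omega>) a s = step_path K (\<lambda>j. u j * indicator {1<..} (a j)) a s"
        if "s \<le> real n" for s
        unfolding step_path_def using that
        by (intro sum.cong) (auto simp: H_def N_def indicator_def)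
      then show ?case using elim by simp
    qed
  qed
qed

text \<open>Existence ensures that the choice in \<open>ito_integral\<close> yields a genuine
  integral; uniqueness then identifies it.\<close>

lemma ito_integral_indicator_step_path:
  assumes X: "indistinguishable M X (\<lambda>t \<omega>. step_path K u a t)"
    and a: "\<And>j. j \<in> K \<Longrightarrow> 0 < a j" and u: "\<And>j. j \<in> K \<Longrightarrow> 0 \<le> u j" "sum u K = 1"
  shows "indistinguishable M (ito_integral M F (\<lambda>t \<omega>. indicator {1<..} t) X)
    (\<lambda>t \<omega>. step_path K (\<lambda>j. u j * indicator {1<..} (a j)) a t)"
proof (rule is_ito_integral_indicator_unique[OF _ X a])
  show "is_ito_integral M F (\<lambda>t \<omega>. indicator {1<..} t) X (ito_integral M F (\<lambda>t \<omega>. indicator {1<..} t) X)"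
    using someI[where P = "is_ito_integral M F (\<lambda>t \<omega>. indicator {1<..} t) X",
        OF is_ito_integral_step_path[OF X a u caglad_path_indicator]]
    by (simp add: ito_integral_def)
qed

end

section \<open>The counterexample\<close>

definition jump_time :: "nat \<Rightarrow> real" where
  "jump_time n = 1 + inverse (real (Suc n))"

lemma jump_time_gt_1: "1 < jump_time n"
  by (simp add: jump_time_def)

lemma jump_time_antimono: "m \<le> n \<Longrightarrow> jump_time n \<le> jump_time m"
  by (simp add: jump_time_def)

text \<open>All jumps of the n-th path lie in (1, 1 + 1/(n+1)]. At s > 1 they have eventually all
  occurred and the weights add up to 1; at s \<le> 1 none has. The limit at 1 itself is thus
  0.\<close>

lemma tendsto_step_path_jump_time:
  assumes "\<And>n. J n \<subseteq> {n..}" "\<And>n. sum (u n) (J n) = 1"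
  shows "(\<lambda>n. step_path (J n) (u n) jump_time s) \<longlonglongrightarrow> indicator {1<..} s"
proof (rule tendsto_eventually, cases "1 < s")
  case True
  then obtain N where N: "inverse (real (Suc N)) < s - 1"
    using reals_Archimedean[of "s - 1"] by auto
  show "\<forall>\<^sub>F n in sequentially. step_path (J n) (u n) jump_time s = indicator {1<..} s"
    using eventually_ge_at_top[of N]
  proof eventually_elim
    case (elim n)
    have "jump_time j \<le> s" if "j \<in> J n" for j
    proof -
      have "N \<le> j" using assms(1)[of n] that elim by auto
      then have "jump_time j \<le> jump_time N" by (rule jump_time_antimono)
      also have "\<dots> \<le> s" using N by (simp add: jump_time_def)
      finally show ?thesis .
    qed
    then show ?case using True by (subst step_path_eq_sum) (auto simp: assms)
  qed
next
  case False
  have "step_path (J n) (u n) jump_time s = 0" for n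
    using False jump_time_gt_1 by (intro step_path_eq_0) (meson le_less_trans not_le)
  then show "\<forall>\<^sub>F n in sequentially. step_path (J n) (u n) jump_time s = indicator {1<..} s"
    using False by simp
qed

text \<open>Limits from the right change the value at 1 from 0 to 1 and so turn the open half-line
  into the closed one, which is the path of \<open>Y\<close>.\<close>

lemma has_right_rational_limit_deterministic:
  assumes Z: "\<And>n. indistinguishable M (Z n) (\<lambda>t \<omega>. x n t)"
    and x: "\<And>s. (\<lambda>n. x n s) \<longlonglongrightarrow> indicator {1<..} s"
  shows "has_right_rational_limit M Z (\<lambda>t \<omega>. indicator {1..} t)"
  unfolding has_right_rational_limit_def
proof (intro exI[of _ "\<lambda>s \<omega>. indicator {1<..} s"] conjI ballI impI)
  fix s :: real assume "0 \<le> s"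
  have "AE \<omega> in M. \<forall>n. \<forall>t\<ge>0. Z n t \<omega> = x n t"
    using Z by (auto simp: AE_all_countable indistinguishable_def)
  then show "AE \<omega> in M. (\<lambda>n. Z n s \<omega>) \<longlonglongrightarrow> indicator {1<..} s"
    by eventually_elim (use x[of s] \<open>0 \<le> s\<close> in simp)
next
  have lim: "((\<lambda>s. indicator {1<..} s :: real) \<longlongrightarrow> indicator {1..} t) (at t within \<rat> \<inter> {t<..})" for t :: real
  proof (rule tendsto_eventually, cases "1 \<le> t")
    \<comment> \<open>For t \<ge> 1, including t = 1, every s > t already exceeds 1.\<close>
    case True
    then show "\<forall>\<^sub>F s in at t within \<rat> \<inter> {t<..}. indicator {1<..} s = (indicator {1..} t :: real)"
      by (auto simp: eventually_at_filter)
  next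
    case False
    then have "\<forall>\<^sub>F s in at t within \<rat> \<inter> {t<..}. s < 1"
      by (intro order_tendstoD(2)[OF tendsto_ident_at]) auto
    then show "\<forall>\<^sub>F s in at t within \<rat> \<inter> {t<..}. indicator {1<..} s = (indicator {1..} t :: real)"
      by eventually_elim (use False in auto)
  qed
  show "AE \<omega> in M. \<forall>t::real\<ge>0. ((\<lambda>s. indicator {1<..} s) \<longlongrightarrow> (indicator {1..} t :: real)) (at t within \<rat> \<inter> {t<..})"
    by (intro AE_I2 allI impI lim)
qed

lemma left_limit_indicator: "left_limit (\<lambda>t \<omega>. indicator {1..} t) = (\<lambda>t \<omega>. indicator {1<..} t)"
proof (intro ext)
  fix t :: real and \<omega> :: 'a
  have "Lim (at_left t) (indicator {1..} :: real \<Rightarrow> real) = indicator {1<..} t"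
    by (intro tendsto_Lim tendsto_eventually eventually_at_left_indicator_atLeast) simp
  then show "left_limit (\<lambda>t \<omega>. indicator {1..} t) t \<omega> = indicator {1<..} t"
    by (auto simp: left_limit_def)
qed

lemma process_hull_jumps:
  assumes "Z \<in> process_hull M ((\<lambda>n t \<omega>. indicator {jump_time n..} t) ` {n..})"
  obtains J u where "J \<subseteq> {n..}" "\<And>j. j \<in> J \<Longrightarrow> 0 \<le> u j" "sum u J = 1"
    "indistinguishable M Z (\<lambda>t \<omega>. step_path J u jump_time t)"
proof -
  define X :: "nat \<Rightarrow> 'a process" where "X = (\<lambda>n t \<omega>. indicator {jump_time n..} t)"
  obtain I u where I: "I \<subseteq> X ` {n..}" "\<And>x. x \<in> I \<Longrightarrow> 0 \<le> u x" "sum u I = 1"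
    and Z: "indistinguishable M Z (\<lambda>t \<omega>. \<Sum>x\<in>I. u x * x t \<omega>)"
    using assms unfolding process_hull_def X_def by blast
  \<comment> \<open>A hull element is indexed by a set of processes. Choosing indices on which
    \<open>X\<close> is injective transports the weights without merging or repeating terms.\<close>
  obtain J where J: "J \<subseteq> {n..}" "inj_on X J" "I = X ` J"
    using I(1) unfolding subset_image_inj by blast
  show thesis
  proof
    show "J \<subseteq> {n..}" by fact
    show "0 \<le> (u \<circ> X) j" if "j \<in> J" for j using that I J by auto
    show "sum (u \<circ> X) J = 1" using I(3) by (simp add: J sum.reindex)
    have "(\<Sum>x\<in>I. u x * x t \<omega>) = step_path J (u \<circ> X) jump_time t" for t \<omega>
      unfolding J(3) step_path_def sum.reindex[OF J(2)] by (simp add: X_def)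
    then show "indistinguishable M Z (\<lambda>t \<omega>. step_path J (u \<circ> X) jump_time t)"
      using Z by simp
  qed
qed

theorem theorem2:
  fixes M :: "'a measure" and F :: "real \<Rightarrow> 'a measure"
  assumes "stochastic_basis M F"
  shows "\<exists>(Y :: 'a process) (X :: nat \<Rightarrow> 'a process).
    semimartingale M F Y \<and>
    (\<forall>n. semimartingale M F (X n) \<and> (AE \<omega> in M. X n 0 \<omega> = 0)) \<and>
    (SUP n. \<integral>\<^sup>+ \<omega>. path_var_infinity (\<lambda>t. X n t \<omega>) \<partial>M) \<le> 1 \<and>
    (\<forall>X' :: nat \<Rightarrow> 'a process. (\<forall>n. X' n \<in> process_hull M (X ` {n..})) \<longrightarrow>
      has_right_rational_limit M X' Y) \<and>
    (\<forall>X' :: nat \<Rightarrow> 'a process. (\<forall>n. X' n \<in> process_hull M (X ` {n..})) \<longrightarrow>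
      (\<exists>L. has_right_rational_limit M (\<lambda>n. ito_integral M F (left_limit Y) (X' n)) L \<and>
        \<not> indistinguishable M L (ito_integral M F (left_limit Y) Y)))"
proof -
  interpret stochastic_basis M F by fact
  define Y :: "'a process" where "Y = (\<lambda>t \<omega>. indicator {1..} t)"
  define X :: "nat \<Rightarrow> 'a process" where "X = (\<lambda>n t \<omega>. indicator {jump_time n..} t)"
  have single: "indistinguishable M (\<lambda>t \<omega>. indicator {a..} t) (\<lambda>t \<omega>. step_path {()} (\<lambda>_. 1) (\<lambda>_. a) t)"
    for a by (simp add: indistinguishable_def step_path_def)
  have Y_minus: "left_limit Y = (\<lambda>t \<omega>. indicator {1<..} t)"
    unfolding Y_def by (rule left_limit_indicator)
  have "semimartingale M F Y" "semimartingale M F (X n)" for n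
    unfolding Y_def X_def by (rule semimartingale_indistinguishable_step_path[OF single]; simp)+
  moreover have "X n 0 \<omega> = 0" for n \<omega>
    using jump_time_gt_1[of n] by (simp add: X_def)
  moreover have "(SUP n. \<integral>\<^sup>+ \<omega>. path_var_infinity (\<lambda>t. X n t \<omega>) \<partial>M) \<le> 1"
  proof -
    have "path_var_infinity (\<lambda>t. X n t \<omega>) = 1" for n \<omega>
      unfolding X_def using jump_time_gt_1[of n] by (intro path_var_infinity_indicator) simp
    then show ?thesis by (simp add: emeasure_space_1)
  qed
  \<comment> \<open>Both iterated limits are \<open>Y\<close>, which is therefore the witness for
    \<open>L\<close>.\<close>
  moreover have "has_right_rational_limit M X' Y \<and>
      has_right_rational_limit M (\<lambda>n. ito_integral M F (left_limit Y) (X' n)) Y"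
    if X': "\<forall>n. X' n \<in> process_hull M (X ` {n..})" for X'
  proof -
    have "\<forall>n. \<exists>J u. J \<subseteq> {n..} \<and> (\<forall>j\<in>J. 0 \<le> u j) \<and> sum u J = 1 \<and>
        indistinguishable M (X' n) (\<lambda>t \<omega>. step_path J u jump_time t)"
      using X' unfolding X_def by (metis process_hull_jumps)
    then obtain J u where J: "\<And>n. J n \<subseteq> {n..}" and u: "\<And>n j. j \<in> J n \<Longrightarrow> 0 \<le> u n j"
      "\<And>n. sum (u n) (J n) = 1"
      and eq: "\<And>n. indistinguishable M (X' n) (\<lambda>t \<omega>. step_path (J n) (u n) jump_time t)"
      by metis
    have lim: "(\<lambda>n. step_path (J n) (u n) jump_time s) \<longlonglongrightarrow> indicator {1<..} s" for s
      using J u(2) by (rule tendsto_step_path_jump_time)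
    have ito: "indistinguishable M (ito_integral M F (left_limit Y) (X' n))
        (\<lambda>t \<omega>. step_path (J n) (u n) jump_time t)" for n
    proof -
      have "0 < jump_time j" for j using jump_time_gt_1[of j] by simp
      \<comment> \<open>Every jump time exceeds 1, so the integrand multiplies each weight by
        1.\<close>
      from ito_integral_indicator_step_path[OF eq this u] show ?thesis
        unfolding Y_minus by (simp add: jump_time_gt_1)
    qed
    show ?thesis
      using has_right_rational_limit_deterministic[OF eq lim]
        has_right_rational_limit_deterministic[OF ito lim]
      by (simp add: Y_def)
  qed
  moreover have "\<not> indistinguishable M Y (ito_integral M F (left_limit Y) Y)"
  proof
    assume "indistinguishable M Y (ito_integral M F (left_limit Y) Y)"
    \<comment> \<open>The only jump of \<open>Y\<close> is at 1, where the integrand is still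
      0.\<close>
    moreover have "indistinguishable M (ito_integral M F (left_limit Y) Y) (\<lambda>t \<omega>. 0)"
      unfolding Y_minus using ito_integral_indicator_step_path[OF single[of 1]]
      by (simp add: Y_def step_path_def)
    ultimately have "indistinguishable M Y (\<lambda>t \<omega>. 0)" by (rule indistinguishable_trans)
    \<comment> \<open>At time 1 the two sides are 1 and 0.\<close>
    then have "AE \<omega> in M. False"
      unfolding indistinguishable_def Y_def by eventually_elim (auto dest!: spec[of _ 1])
    then show False by simp
  qed
  ultimately show ?thesis by (auto intro!: exI[of _ Y] exI[of _ X])
qed

end
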